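(* Let $P \subseteq \mathbb{R}^d$ be a polytope. Then $P$ is a reflexive polytope if and only if both $P$ and its dual $P^*$ are semi-reflexive polytopes.
   Context: For a polytope $Q \subseteq \mathbb{R}^d$ and real $s > 0$, let $L_Q(s) = \#(sQ \cap \mathbb{Z}^d)$ with $sQ = \{sx \mid x \in Q\}$; by convention $L_Q(0)=1$. A polytope $Q$ is semi-reflexive if it is rational (all vertices rational) and $L_Q(s) = L_Q(\lfloor s \rfloor)$ for all real $s \ge 0$ (in particular, a semi-reflexive polytope is bounded). The dual of $P$ is $P^* = \{x \in \mathbb{R}^d \mid \langle x, y\rangle \le 1 \text{ for all } y \in P\}$. A polytope $P$ is reflexive if it is an integer polytope (all vertices in $\mathbb{Z}^d$) that can be written as $P = \{x \in \mathbb{R}^d \mid Ax \le \mathbf{1}\}$ for some integer matrix $A$, where $\mathbf{1}$ is the all-ones vector; equivalently, both $P$ and $P^*$ are integer polytopes. *)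

theory Defs
  imports "HOL-Analysis.Analysis"
begin

definition int_vec :: "real ^ 'n \<Rightarrow> bool" where
  "int_vec x \<longleftrightarrow> (\<forall>i. x $ i \<in> \<int>)"

definition rat_vec :: "real ^ 'n \<Rightarrow> bool" where
  "rat_vec x \<longleftrightarrow> (\<forall>i. x $ i \<in> \<rat>)"

text \<open>The vertices of a polytope are its extreme points.\<close>

definition integer_polytope :: "(real ^ 'n) set \<Rightarrow> bool" where
  "integer_polytope P \<longleftrightarrow> polytope P \<and> (\<forall>v. v extreme_point_of P \<longrightarrow> int_vec v)"

definition rational_polytope :: "(real ^ 'n) set \<Rightarrow> bool" where
  "rational_polytope P \<longleftrightarrow> polytope P \<and> (\<forall>v. v extreme_point_of P \<longrightarrow> rat_vec v)"

text \<open>The value at dilation factor 0 is 1 by convention; this differs from the cardinality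
  only for the empty polytope.  For a polytope \<open>Q\<close> the counted set is finite.\<close>

definition lattice_count :: "(real ^ 'n) set \<Rightarrow> real \<Rightarrow> nat" where
  "lattice_count Q s = (if s = 0 then 1 else card ((\<lambda>x. s *\<^sub>R x) ` Q \<inter> {z. int_vec z}))"

definition semi_reflexive :: "(real ^ 'n) set \<Rightarrow> bool" where
  "semi_reflexive Q \<longleftrightarrow>
     rational_polytope Q \<and> (\<forall>s\<ge>0. lattice_count Q s = lattice_count Q (real_of_int \<lfloor>s\<rfloor>))"

definition polar_dual :: "(real ^ 'n) set \<Rightarrow> (real ^ 'n) set" where
  "polar_dual P = {x. \<forall>y\<in>P. x \<bullet> y \<le> 1}"

text \<open>The integer matrix is given by its finite family of rows \<open>a 0, \<dots>, a (m - 1)\<close>,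
  since the number of rows is existentially quantified and so cannot be a type.\<close>

definition reflexive_polytope :: "(real ^ 'n) set \<Rightarrow> bool" where
  "reflexive_polytope P \<longleftrightarrow>
     integer_polytope P \<and>
     (\<exists>(m::nat) (a :: nat \<Rightarrow> real ^ 'n). (\<forall>i<m. int_vec (a i)) \<and> P = {x. \<forall>i<m. a i \<bullet> x \<le> 1})"

end

theory Submission
  imports Defs
begin

text \<open>For a polytope \<open>R\<close> containing the origin with polar dual \<open>Q\<close>, a point \<open>z\<close> lies in \<open>s Q\<close>
  (for \<open>s > 0\<close>) iff \<open>h z \<le> s\<close>, where \<open>h z\<close> is the maximum of \<open>u \<bullet> z\<close> over \<open>u \<in> R\<close>.  Hence \<open>Q\<close> is
  semi-reflexive only if \<open>h\<close> takes integer values at lattice points.  On the normal cone of a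
  vertex \<open>v\<close> of \<open>R\<close> the function \<open>h\<close> is \<open>z \<mapsto> v \<bullet> z\<close>, and since this cone is full-dimensional it
  contains a lattice point \<open>z\<close> together with all its neighbours \<open>z + e\<^sub>i\<close>; taking differences,
  \<open>v\<close> is integral.  Applying this to \<open>R = P\<close> and to \<open>R = P\<^sup>*\<close> shows that \<open>P\<close> is reflexive.
  Conversely, for an integer matrix \<open>A\<close> and a lattice point \<open>z\<close>, \<open>A z \<le> s\<close> holds iff
  \<open>A z \<le> \<lfloor>s\<rfloor>\<close>.\<close>

section \<open>Lattice points of bounded sets\<close>

lemma int_vec_0 [simp]: "int_vec 0"
  by (simp add: int_vec_def)

lemma int_vec_inner: "int_vec a \<Longrightarrow> int_vec z \<Longrightarrow> a \<bullet> z \<in> \<int>"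
  unfolding inner_vec_def int_vec_def by (auto intro!: Ints_sum Ints_mult)

lemma int_vec_norm_less_1:
  assumes "int_vec z" "norm z < 1"
  shows "z = 0"
proof -
  have "z $ i = 0" for i
    using assms component_le_norm_cart[of z i] Ints_nonzero_abs_less1[of "z $ i"]
    by (auto simp: int_vec_def)
  then show ?thesis
    by (simp add: vec_eq_iff)
qed

lemma finite_int_vec_bounded:
  fixes S :: "(real ^ 'n) set"
  assumes "bounded S"
  shows "finite (S \<inter> {z. int_vec z})"
proof -
  obtain B where B: "\<And>x. x \<in> S \<Longrightarrow> norm x \<le> B"
    using assms by (auto simp: bounded_iff)
  define K where "K = (of_int :: int \<Rightarrow> real) ` {-\<lceil>B\<rceil>..\<lceil>B\<rceil>}"
  have "z $ i \<in> K" if z: "z \<in> S" "int_vec z" for z i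
  proof -
    obtain k where k: "z $ i = of_int k"
      using z(2) by (auto simp: int_vec_def elim: Ints_cases)
    have "\<bar>real_of_int k\<bar> \<le> B"
      using B[OF z(1)] component_le_norm_cart[of z i] k by simp
    then have "k \<in> {-\<lceil>B\<rceil>..\<lceil>B\<rceil>}"
      by (simp add: abs_le_iff) linarith
    then show ?thesis
      by (auto simp: k K_def)
  qed
  then have "S \<inter> {z. int_vec z} \<subseteq> vec_lambda ` (UNIV \<rightarrow>\<^sub>E K)"
    by (auto intro!: image_eqI[where x = "vec_nth _"])
  moreover have "finite (vec_lambda ` (UNIV \<rightarrow>\<^sub>E K))"
    by (intro finite_imageI finite_PiE) (auto simp: K_def)
  ultimately show ?thesis
    by (rule finite_subset)
qed

lemma integer_polytope_imp_rational: "integer_polytope P \<Longrightarrow> rational_polytope P"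
  using Ints_subset_Rats
  by (auto simp: integer_polytope_def rational_polytope_def int_vec_def rat_vec_def)

section \<open>Polar duality\<close>

lemma zero_in_polar_dual [simp]: "0 \<in> polar_dual S"
  by (simp add: polar_dual_def)

lemma polar_dual_hull: "polar_dual (convex hull S) = polar_dual S"
proof -
  have "x \<in> polar_dual (convex hull S)" if "x \<in> polar_dual S" for x
  proof -
    have "convex hull S \<subseteq> {y. x \<bullet> y \<le> 1}"
      using that by (intro hull_minimal) (auto simp: polar_dual_def convex_halfspace_le)
    then show ?thesis
      by (auto simp: polar_dual_def)
  qed
  then show ?thesis
    using hull_subset[of S convex] by (auto simp: polar_dual_def)
qed

lemma polar_dual_bipolar:
  assumes "closed S" "convex S" "0 \<in> S"
  shows "polar_dual (polar_dual S) = S"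
proof
  show "S \<subseteq> polar_dual (polar_dual S)"
    by (auto simp: polar_dual_def inner_commute)
  show "polar_dual (polar_dual S) \<subseteq> S"
  proof
    fix y assume y: "y \<in> polar_dual (polar_dual S)"
    show "y \<in> S"
    proof (rule ccontr)
      assume "y \<notin> S"
      then obtain a b where ab: "a \<bullet> y < b" "\<And>x. x \<in> S \<Longrightarrow> a \<bullet> x > b"
        using separating_hyperplane_closed_point[OF assms(2,1)] by blast
      have b: "b < 0"
        using ab(2)[OF assms(3)] by simp
      \<comment> \<open>Dividing by the negative \<open>b\<close> turns the separation into values
        below 1 on \<open>S\<close> and above 1 at \<open>y\<close>.\<close>
      have "a /\<^sub>R b \<in> polar_dual S"
        using ab(2) b by (auto simp: polar_dual_def field_simps less_imp_le)
      then have "y \<bullet> (a /\<^sub>R b) \<le> 1"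
        using y unfolding polar_dual_def[of "polar_dual S"] by blast
      then show False
        using ab(1) b by (simp add: field_simps inner_commute)
    qed
  qed
qed

text \<open>This allows a polytope to be replaced by its finite set of vertices when its dual is
  formed.\<close>

lemma polar_dual_extreme_points:
  assumes "polytope P"
  shows "polar_dual {v. v extreme_point_of P} = polar_dual P"
  using Krein_Milman_Minkowski[OF polytope_imp_compact polytope_imp_convex] assms
    polar_dual_hull by metis

lemma polar_dual_scaleR_iff:
  assumes "s > 0"
  shows "z \<in> (\<lambda>x. s *\<^sub>R x) ` polar_dual S \<longleftrightarrow> (\<forall>u\<in>S. u \<bullet> z \<le> s)"
proof -
  have "z \<in> (\<lambda>x. s *\<^sub>R x) ` polar_dual S \<longleftrightarrow> z /\<^sub>R s \<in> polar_dual S"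
    using assms by (auto intro!: image_eqI[where x = "z /\<^sub>R s"])
  then show ?thesis
    using assms by (simp add: polar_dual_def field_simps inner_commute)
qed

text \<open>Each \<open>a \<bullet> z\<close> with \<open>z\<close> a lattice point is an integer,
  so the bounds \<open>s\<close> and \<open>\<lfloor>s\<rfloor>\<close> cut out the same lattice
  points. For \<open>s < 1\<close> the count has to match the conventional value 1, which uses
  boundedness.\<close>

lemma semi_reflexive_polar_dual:
  assumes A: "\<And>a. a \<in> A \<Longrightarrow> int_vec a" and R: "rational_polytope (polar_dual A)"
  shows "semi_reflexive (polar_dual A)"
  unfolding semi_reflexive_def
proof (intro conjI R allI impI)
  fix s :: real assume "s \<ge> 0"
  define Q where "Q = polar_dual A"
  have floor_iff: "(\<forall>a\<in>A. a \<bullet> z \<le> s) \<longleftrightarrow> (\<forall>a\<in>A. a \<bullet> z \<le> real_of_int \<lfloor>s\<rfloor>)" if z: "int_vec z" for z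
  proof (intro ball_cong refl)
    fix a assume "a \<in> A"
    then obtain k where "a \<bullet> z = of_int k"
      using int_vec_inner A z by (meson Ints_cases)
    then show "a \<bullet> z \<le> s \<longleftrightarrow> a \<bullet> z \<le> real_of_int \<lfloor>s\<rfloor>"
      by (simp add: le_floor_iff)
  qed
  show "lattice_count Q s = lattice_count Q (real_of_int \<lfloor>s\<rfloor>)"
  proof (cases "s < 1")
    case True
    then have floor0: "\<lfloor>s\<rfloor> = 0"
      using \<open>s \<ge> 0\<close> by (simp add: floor_eq_iff)
    have "(\<lambda>x. s *\<^sub>R x) ` Q \<inter> {z. int_vec z} = {0}" if s: "s > 0"
    proof -
      obtain B where B: "\<And>x. x \<in> Q \<Longrightarrow> norm x \<le> B"
        using R polytope_imp_bounded[of Q] unfolding rational_polytope_def Q_def bounded_iff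
        by blast
      have "z = 0" if z: "z \<in> (\<lambda>x. s *\<^sub>R x) ` Q" "int_vec z" for z
      proof (rule ccontr)
        assume "z \<noteq> 0"
        \<comment> \<open>All \<open>a \<bullet> z\<close> are at most 0, so the whole ray through
          \<open>z\<close> stays in \<open>Q\<close>; this \<open>t\<close> gives a point of norm
          \<open>\<bar>B\<bar> + 1\<close>, beyond the bound.\<close>
        define t where "t = (\<bar>B\<bar> + 1) / norm z"
        have t: "t > 0"
          using \<open>z \<noteq> 0\<close> by (simp add: t_def add_nonneg_pos)
        have le0: "\<forall>a\<in>A. a \<bullet> z \<le> 0"
          using z polar_dual_scaleR_iff[OF s, of z A] floor_iff[OF z(2)] floor0
          by (simp add: Q_def)
        have "t *\<^sub>R z \<in> Q"
          unfolding Q_def polar_dual_def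
          using le0 t by (auto simp: inner_commute intro!: order_trans[OF mult_nonneg_nonpos])
        then have "norm (t *\<^sub>R z) \<le> B" by (rule B)
        then show False
          using \<open>z \<noteq> 0\<close> by (simp add: t_def)
      qed
      moreover have "0 \<in> (\<lambda>x. s *\<^sub>R x) ` Q"
        by (auto simp: Q_def intro!: image_eqI[where x = 0])
      ultimately show ?thesis by auto
    qed
    then show ?thesis
      using \<open>s \<ge> 0\<close> floor0 by (auto simp: lattice_count_def)
  next
    case False
    then have pos: "real_of_int \<lfloor>s\<rfloor> > 0" "s > 0" by auto
    have "(\<lambda>x. s *\<^sub>R x) ` Q \<inter> {z. int_vec z} =
        (\<lambda>x. real_of_int \<lfloor>s\<rfloor> *\<^sub>R x) ` Q \<inter> {z. int_vec z}"
      unfolding Q_def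
      by (intro set_eqI)
        (use floor_iff in \<open>simp only: Int_iff mem_Collect_eq polar_dual_scaleR_iff[OF pos(1)]
          polar_dual_scaleR_iff[OF pos(2)], blast\<close>)
    then show ?thesis
      using less_imp_neq[OF pos(1)] less_imp_neq[OF pos(2)] by (simp add: lattice_count_def)
  qed
qed

section \<open>Consequences of semi-reflexivity\<close>

lemma semi_reflexive_zero_mem:
  assumes "semi_reflexive P"
  shows "0 \<in> P"
proof -
  obtain B where B: "B > 0" "\<And>x. x \<in> P \<Longrightarrow> norm x \<le> B"
    using assms polytope_imp_bounded[of P]
    by (auto simp: semi_reflexive_def rational_polytope_def bounded_pos)
  \<comment> \<open>The dilate by this \<open>s\<close> lies in the open unit ball, whose only
    lattice point is 0, and its count must equal the conventional value 1.\<close>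
  define s where "s = 1 / (B + 1)"
  have s: "0 < s" "s < 1" "s * B < 1"
    using B(1) by (auto simp: s_def field_simps)
  have "\<lfloor>s\<rfloor> = 0"
    using s by (simp add: floor_eq_iff)
  then have "lattice_count P s = lattice_count P 0"
    using assms s(1) unfolding semi_reflexive_def by (metis less_imp_le of_int_0)
  then have "(\<lambda>x. s *\<^sub>R x) ` P \<inter> {z. int_vec z} \<noteq> {}"
    using s(1) by (auto simp: lattice_count_def)
  then obtain x where x: "x \<in> P" "int_vec (s *\<^sub>R x)" by auto
  have "norm (s *\<^sub>R x) \<le> s * B"
    using B(2)[OF x(1)] s(1) by simp
  then have "s *\<^sub>R x = 0"
    using x(2) s(3) by (intro int_vec_norm_less_1) auto
  with x(1) s(1) show ?thesis by simp
qed

text \<open>As \<open>Q\<close> is convex and contains 0, its dilates are nested; nested finite sets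
  of lattice points with equal counts coincide.\<close>

lemma semi_reflexive_lattice_points:
  fixes Q :: "(real ^ 'n) set"
  assumes Q: "semi_reflexive Q" and "s > 0" and z: "int_vec z" "z \<in> (\<lambda>x. s *\<^sub>R x) ` Q"
  shows "z \<in> (\<lambda>x. real_of_int \<lfloor>s\<rfloor> *\<^sub>R x) ` Q"
proof -
  let ?L = "\<lambda>t. (\<lambda>x. t *\<^sub>R x) ` Q \<inter> {z. int_vec z}"
  let ?m = "real_of_int \<lfloor>s\<rfloor>"
  have poly: "polytope Q"
    using Q by (simp add: semi_reflexive_def rational_polytope_def)
  have zero: "0 \<in> Q"
    using Q by (rule semi_reflexive_zero_mem)
  have fin: "finite (?L s)"
    using poly by (intro finite_int_vec_bounded bounded_scaling polytope_imp_bounded)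
  have sub: "?L ?m \<subseteq> ?L s"
  proof -
    have "?m *\<^sub>R x \<in> (\<lambda>x. s *\<^sub>R x) ` Q" if "x \<in> Q" for x
    proof -
      have "(?m / s) *\<^sub>R x \<in> Q"
        using convexD_alt[OF polytope_imp_convex[OF poly] zero that, of "?m / s"] \<open>s > 0\<close>
        by auto
      then show ?thesis
        using \<open>s > 0\<close> by (intro image_eqI[where x = "(?m / s) *\<^sub>R x"]) auto
    qed
    then show ?thesis by auto
  qed
  \<comment> \<open>If \<open>\<lfloor>s\<rfloor> = 0\<close>, the conventional value 1 is thus the
    true cardinality.\<close>
  have "(\<lambda>x. 0 *\<^sub>R x) ` Q = {0}"
    using zero by auto
  then have "card (?L ?m) = lattice_count Q ?m"
    by (auto simp: lattice_count_def)
  also have "\<dots> = card (?L s)"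
  proof -
    have "lattice_count Q s = lattice_count Q ?m"
      using Q \<open>s > 0\<close> unfolding semi_reflexive_def by (meson less_imp_le)
    then show ?thesis
      using \<open>s > 0\<close> by (simp add: lattice_count_def)
  qed
  finally have "?L ?m = ?L s"
    using card_subset_eq[OF fin sub] by simp
  then show ?thesis
    using z by auto
qed

section \<open>Lattice points in open cones\<close>

lemma tendsto_floor_divide:
  "(\<lambda>n. real_of_int \<lfloor>real n * x\<rfloor> / real n) \<longlonglongrightarrow> x"
proof (rule Lim_transform_eventually)
  have "(\<lambda>n. frac (real n * x) * inverse (real n)) \<longlonglongrightarrow> 0"
  proof (rule Lim_null_comparison[OF _ lim_inverse_n])
    show "\<forall>\<^sub>F n in sequentially. norm (frac (real n * x) * inverse (real n)) \<le> inverse (real n)"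
      by (intro always_eventually allI) (simp add: mult_left_le_one_le abs_mult frac_lt_1 less_imp_le)
  qed
  then show "(\<lambda>n. x - frac (real n * x) * inverse (real n)) \<longlonglongrightarrow> x"
    using tendsto_diff[OF tendsto_const] by fastforce
  show "\<forall>\<^sub>F n in sequentially. x - frac (real n * x) * inverse (real n)
      = real_of_int \<lfloor>real n * x\<rfloor> / real n"
    using eventually_gt_at_top[of 0] by eventually_elim (simp add: frac_def field_simps)
qed

lemma open_cone_contains_lattice_neighbours:
  fixes C :: "(real ^ 'n) set"
  assumes "open C" "x \<in> C" and cone: "\<And>y t. y \<in> C \<Longrightarrow> t > 0 \<Longrightarrow> t *\<^sub>R y \<in> C"
  obtains z where "int_vec z" "z \<in> C" "\<And>i. z + axis i 1 \<in> C"
proof -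
  \<comment> \<open>Rounding \<open>n x\<close> down moves it by a bounded amount, as does adding a
    fixed \<open>w\<close>; after division by \<open>n\<close> both errors vanish in the
    limit.\<close>
  define z where "z n = (\<chi> j. real_of_int \<lfloor>real n * x $ j\<rfloor>)" for n :: nat
  have lim: "(\<lambda>n. z n /\<^sub>R real n) \<longlonglongrightarrow> x"
    using tendsto_floor_divide by (intro vec_tendstoI) (simp add: z_def divide_inverse_commute)
  have lim': "(\<lambda>n. (z n + w) /\<^sub>R real n) \<longlonglongrightarrow> x" for w
    using tendsto_add[OF lim tendsto_scaleR[OF lim_inverse_n tendsto_const[of w]]]
    by (simp add: scaleR_right_distrib)
  have ev: "\<forall>\<^sub>F n in sequentially. z n + w \<in> C" for w
    using topological_tendstoD[OF lim' assms(1,2), of w] eventually_gt_at_top[of 0]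
  proof eventually_elim
    case (elim n)
    then show ?case
      using cone[OF elim(1), of "real n"] by simp
  qed
  have "\<forall>\<^sub>F n in sequentially. z n + 0 \<in> C \<and> (\<forall>i. z n + axis i 1 \<in> C)"
    by (intro eventually_conj ev eventually_all_finite)
  then obtain n where "z n \<in> C" "\<And>i. z n + axis i 1 \<in> C"
    by (auto simp: eventually_sequentially)
  moreover have "int_vec (z n)"
    by (simp add: z_def int_vec_def)
  ultimately show ?thesis
    using that by blast
qed

section \<open>Integrality of vertices\<close>

lemma polytope_vertex_exposed:
  fixes R :: "(real ^ 'n) set"
  assumes "polytope R" "v extreme_point_of R"
  shows "\<exists>x. \<forall>u. u extreme_point_of R \<longrightarrow> u \<noteq> v \<longrightarrow> u \<bullet> x < v \<bullet> x"
proof -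
  let ?S = "{u. u extreme_point_of R} - {v}"
  have fin: "finite ?S"
    using finite_polyhedron_extreme_points[OF polytope_imp_polyhedron[OF assms(1)]] by simp
  \<comment> \<open>Removing an extreme point leaves a convex set, so \<open>v\<close> can be
    strictly separated from the hull of the other vertices.\<close>
  have "convex hull ?S \<subseteq> R - {v}"
  proof (rule hull_minimal)
    show "convex (R - {v})"
      using assms polytope_imp_convex extreme_point_of_stillconvex by blast
  qed (auto simp: extreme_point_of_def)
  then have "v \<notin> convex hull ?S" by blast
  then obtain a b where ab: "a \<bullet> v < b" "\<And>u. u \<in> convex hull ?S \<Longrightarrow> a \<bullet> u > b"
    using separating_hyperplane_closed_point[of "convex hull ?S" v]
      compact_imp_closed[OF finite_imp_compact_convex_hull[OF fin]] by auto
  show ?thesis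
  proof (intro exI[of _ "- a"] allI impI)
    fix u assume "u extreme_point_of R" "u \<noteq> v"
    then have "a \<bullet> u > b"
      by (intro ab(2) hull_inc) auto
    with ab(1) show "u \<bullet> - a < v \<bullet> - a"
      by (simp add: inner_commute)
  qed
qed

lemma integer_polytope_of_semi_reflexive_dual:
  fixes R :: "(real ^ 'n) set"
  assumes R: "polytope R" "0 \<in> R" and sr: "semi_reflexive (polar_dual R)"
  shows "integer_polytope R"
  unfolding integer_polytope_def
proof (intro conjI R(1) allI impI)
  fix v assume v: "v extreme_point_of R"
  let ?E = "{u. u extreme_point_of R}"
  \<comment> \<open>The open normal cone of \<open>v\<close>: the directions in which
    \<open>v\<close> strictly beats every other vertex.\<close>
  define C where "C = (\<Inter>u\<in>?E - {v}. {y. u \<bullet> y < v \<bullet> y})"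
  have R_hull: "R = convex hull ?E"
    using Krein_Milman_Minkowski R(1) polytope_imp_compact polytope_imp_convex by blast
  have h: "v \<bullet> y \<in> \<int>" if y: "int_vec y" "y \<in> C" for y
  proof -
    have "y \<bullet> u \<le> v \<bullet> y" if "u \<in> ?E" for u
      using that y(2) by (cases "u = v") (auto simp: C_def inner_commute intro: less_imp_le)
    then have "convex hull ?E \<subseteq> {u. y \<bullet> u \<le> v \<bullet> y}"
      by (intro hull_minimal convex_halfspace_le) blast
    then have le: "u \<bullet> y \<le> v \<bullet> y" if "u \<in> R" for u
      using that R_hull by (auto simp: inner_commute)
    show ?thesis
    proof (cases "v \<bullet> y > 0")
      case True
      define m where "m = \<lfloor>v \<bullet> y\<rfloor>"
      have "y \<in> (\<lambda>x. (v \<bullet> y) *\<^sub>R x) ` polar_dual R"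
        using le by (simp add: polar_dual_scaleR_iff[OF True])
      \<comment> \<open>Semi-reflexivity rounds the dilation factor down, which will give
        \<open>v \<bullet> y \<le> \<lfloor>v \<bullet> y\<rfloor>\<close> and hence
        integrality.\<close>
      then have mem: "y \<in> (\<lambda>x. real_of_int m *\<^sub>R x) ` polar_dual R"
        unfolding m_def by (rule semi_reflexive_lattice_points[OF sr True y(1)])
      \<comment> \<open>The inequality description of dilates needs a positive factor; the dilate by
        0 contains at most the origin.\<close>
      have "m > 0"
      proof (rule ccontr)
        assume "\<not> m > 0"
        moreover have "m \<ge> 0"
          using True by (simp add: m_def)
        ultimately have "y = 0"
          using mem by auto
        with True show False by simp
      qed
      then have "v \<bullet> y \<le> real_of_int m"
        using mem v by (simp add: polar_dual_scaleR_iff extreme_point_of_def)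
      then have "v \<bullet> y = real_of_int m"
        by (simp add: m_def antisym)
      then show ?thesis by simp
    next
      case False
      then have "v \<bullet> y = 0"
        using le[OF R(2)] by simp
      then show ?thesis by simp
    qed
  qed
  have "finite ?E"
    by (rule finite_polyhedron_extreme_points[OF polytope_imp_polyhedron[OF R(1)]])
  then have openC: "open C"
    unfolding C_def by (intro open_INT ballI open_Collect_less continuous_intros) auto
  obtain x where "\<forall>u. u extreme_point_of R \<longrightarrow> u \<noteq> v \<longrightarrow> u \<bullet> x < v \<bullet> x"
    using polytope_vertex_exposed[OF R(1) v] by blast
  then have "x \<in> C"
    by (simp add: C_def)
  moreover have "t *\<^sub>R y \<in> C" if "y \<in> C" "t > 0" for y t
    using that by (simp add: C_def)
  ultimately obtain z where z: "int_vec z" "z \<in> C" "\<And>i. z + axis i 1 \<in> C"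
    using open_cone_contains_lattice_neighbours[OF openC] by blast
  show "int_vec v"
    unfolding int_vec_def
  proof
    fix i
    have "int_vec (z + axis i 1)"
      using z(1) by (auto simp: int_vec_def axis_def)
    then have "v \<bullet> (z + axis i 1) - v \<bullet> z \<in> \<int>"
      using h z by (intro Ints_diff) auto
    then show "v $ i \<in> \<int>"
      by (simp add: inner_add_right inner_axis)
  qed
qed

text \<open>Viewing the rows as a finite set makes \<open>P\<close> a polar dual, so that the
  duality lemmas apply.\<close>

lemma reflexive_polytope_altdef:
  "reflexive_polytope P \<longleftrightarrow>
     integer_polytope P \<and> (\<exists>A. finite A \<and> (\<forall>a\<in>A. int_vec a) \<and> P = polar_dual A)"
proof -
  have "(\<exists>(m::nat) a. (\<forall>i<m. int_vec (a i)) \<and> P = {x. \<forall>i<m. a i \<bullet> x \<le> 1}) \<longleftrightarrow>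
      (\<exists>A. finite A \<and> (\<forall>a\<in>A. int_vec a) \<and> P = polar_dual A)" (is "?L \<longleftrightarrow> ?R")
  proof
    assume ?L
    then obtain m :: nat and a where "\<forall>i<m. int_vec (a i)" "P = {x. \<forall>i<m. a i \<bullet> x \<le> 1}"
      by blast
    then show ?R
      by (intro exI[of _ "a ` {..<m}"]) (auto simp: polar_dual_def inner_commute)
  next
    assume ?R
    then obtain A where A: "finite A" "\<forall>a\<in>A. int_vec a" "P = polar_dual A" by blast
    obtain m :: nat and a where "A = a ` {i. i < m}"
      using A(1) finite_imp_nat_seg_image_inj_on by blast
    with A show ?L
      by (intro exI[of _ m] exI[of _ a]) (auto simp: polar_dual_def inner_commute)
  qed
  then show ?thesis
    by (simp add: reflexive_polytope_def)
qed

theorem theorem8: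
  fixes P :: "(real ^ 'n) set"
  assumes "polytope P"
  shows "reflexive_polytope P \<longleftrightarrow> semi_reflexive P \<and> semi_reflexive (polar_dual P)"
proof
  assume "reflexive_polytope P"
  then obtain A where P: "integer_polytope P"
    and A: "finite A" "\<And>a. a \<in> A \<Longrightarrow> int_vec a" and PA: "P = polar_dual A"
    by (auto simp: reflexive_polytope_altdef)
  have "semi_reflexive P"
    using semi_reflexive_polar_dual[OF A(2)] integer_polytope_imp_rational[OF P] by (simp add: PA)
  \<comment> \<open>Adjoining 0 leaves the dual unchanged and makes the bipolar theorem applicable,
    which identifies the dual of \<open>P\<close> with \<open>H\<close>.\<close>
  define H where "H = convex hull (insert 0 A)"
  have "polytope H"
    using A(1) by (auto simp: H_def polytope_def)
  have "P = polar_dual H"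
    unfolding H_def polar_dual_hull PA by (simp add: polar_dual_def)
  moreover have "0 \<in> H"
    by (simp add: H_def hull_inc)
  ultimately have dual: "polar_dual P = H"
    using \<open>polytope H\<close> polar_dual_bipolar polytope_imp_closed polytope_imp_convex by blast
  have "integer_polytope H"
    using \<open>polytope H\<close> A(2) extreme_point_of_convex_hull
    by (fastforce simp: integer_polytope_def H_def)
  \<comment> \<open>The vertices of \<open>P\<close> are integral and have the same dual as
    \<open>P\<close>.\<close>
  then have "semi_reflexive (polar_dual {v. v extreme_point_of P})"
    using P integer_polytope_imp_rational
    by (intro semi_reflexive_polar_dual)
      (auto simp: integer_polytope_def dual polar_dual_extreme_points[OF assms])
  then show "semi_reflexive P \<and> semi_reflexive (polar_dual P)"
    using \<open>semi_reflexive P\<close> by (simp add: polar_dual_extreme_points[OF assms])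
next
  assume sr: "semi_reflexive P \<and> semi_reflexive (polar_dual P)"
  let ?V = "{v. v extreme_point_of polar_dual P}"
  have zero: "0 \<in> P"
    using sr semi_reflexive_zero_mem by blast
  have bipolar: "polar_dual (polar_dual P) = P"
    using assms zero by (intro polar_dual_bipolar polytope_imp_closed polytope_imp_convex)
  have poly: "polytope (polar_dual P)"
    using sr by (simp add: semi_reflexive_def rational_polytope_def)
  have "integer_polytope P"
    using assms zero sr by (intro integer_polytope_of_semi_reflexive_dual) auto
  moreover have "integer_polytope (polar_dual P)"
    using poly sr by (intro integer_polytope_of_semi_reflexive_dual) (auto simp: bipolar)
  moreover have "finite ?V"
    using finite_polyhedron_extreme_points[OF polytope_imp_polyhedron[OF poly]] .
  \<comment> \<open>The vertices of the dual serve as the rows of the integer matrix.\<close>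
  moreover have "P = polar_dual ?V"
    using bipolar by (simp add: polar_dual_extreme_points[OF poly])
  ultimately show "reflexive_polytope P"
    unfolding reflexive_polytope_altdef by (auto simp: integer_polytope_def)
qed

end
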